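(* Let $G$ be a graph and $v$ a vertex of $G$. Then $G$ is a nut graph if and only if its Fowler Construction $F(G,v)$ is a nut graph.
   Context: All graphs are finite and simple. For a graph $G$ with 0--1 adjacency matrix $\mathbf{A}(G)$, the nullity is the multiplicity of $0$ as an eigenvalue of $\mathbf{A}(G)$. A vertex is a core vertex if it corresponds to a nonzero entry of some vector in $\ker \mathbf{A}(G)$; a core graph is a singular graph all of whose vertices are core vertices; a nut graph is a core graph of nullity one. Fowler Construction: let $v$ have degree $\rho$ with neighbours $u_1,\dots,u_\rho$. The graph $F(G,v)$ is obtained from $G$ by adding $2\rho$ new vertices $p_1,\dots,p_\rho,q_1,\dots,q_\rho$; for each $i$, deleting the edge $vu_i$ and adding edges $vq_i$ and $p_iu_i$; and finally adding the edges $p_iq_j$ for all $i,j\in\{1,\dots,\rho\}$ with $i\neq j$. *)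

theory Defs
  imports
    "Graph_Theory.Pair_Digraph"
    "Jordan_Normal_Form.Char_Poly"
    "Jordan_Normal_Form.Matrix_Kernel"
begin

text \<open>
  A finite simple graph is a \<open>pair_graph\<close>: a finite loop-free digraph whose arcs form a
  symmetric relation on the vertex set, an edge being represented by its two opposite arcs.
\<close>

text \<open>
  Rows and columns of a matrix are indexed by natural numbers, so an arbitrary ordering of the
  vertices is chosen. The notions below do not depend on this choice, because another ordering
  conjugates the adjacency matrix by a permutation matrix.
\<close>

definition vertex_list :: "'a pair_pre_digraph \<Rightarrow> 'a list" where
  "vertex_list G = (SOME vs. distinct vs \<and> set vs = pverts G)"

lemma vertex_list:
  assumes "finite (pverts G)"
  shows "distinct (vertex_list G)" and "set (vertex_list G) = pverts G"
proof -
  have "\<exists>vs. distinct vs \<and> set vs = pverts G"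
    using finite_distinct_list[OF assms] by blast
  then have "distinct (vertex_list G) \<and> set (vertex_list G) = pverts G"
    unfolding vertex_list_def by (rule someI_ex)
  then show "distinct (vertex_list G)" and "set (vertex_list G) = pverts G"
    by auto
qed

definition adjacency_matrix :: "'a pair_pre_digraph \<Rightarrow> real mat" where
  "adjacency_matrix G =
    (let vs = vertex_list G; n = length vs
     in mat n n (\<lambda>(i, j). if (vs ! i, vs ! j) \<in> parcs G then 1 else 0))"

text \<open>The algebraic multiplicity of the eigenvalue 0:\<close>

definition nullity :: "'a pair_pre_digraph \<Rightarrow> nat" where
  "nullity G = Polynomial.order 0 (char_poly (adjacency_matrix G))"

definition singular_graph :: "'a pair_pre_digraph \<Rightarrow> bool" where
  "singular_graph G \<longleftrightarrow> \<not> invertible_mat (adjacency_matrix G)"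

definition core_vertex :: "'a pair_pre_digraph \<Rightarrow> 'a \<Rightarrow> bool" where
  "core_vertex G u \<longleftrightarrow>
    (\<exists>x \<in> mat_kernel (adjacency_matrix G).
      \<exists>i < length (vertex_list G). vertex_list G ! i = u \<and> x $ i \<noteq> 0)"

definition core_graph :: "'a pair_pre_digraph \<Rightarrow> bool" where
  "core_graph G \<longleftrightarrow> singular_graph G \<and> (\<forall>u \<in> pverts G. core_vertex G u)"

definition nut_graph :: "'a pair_pre_digraph \<Rightarrow> bool" where
  "nut_graph G \<longleftrightarrow> core_graph G \<and> nullity G = 1"

definition neighbours :: "'a pair_pre_digraph \<Rightarrow> 'a \<Rightarrow> 'a set" where
  "neighbours G v = {u. (v, u) \<in> parcs G}"

text \<open>
  The new vertices of the Fowler construction are indexed by the neighbours of \<open>v\<close> themselves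
  instead of by positions in an enumeration of them: if the neighbours are
  \<open>u\<^sub>1, \<dots>, u\<^sub>\<rho>\<close>, then \<open>P u\<^sub>i\<close> is the vertex \<open>p\<^sub>i\<close> and
  \<open>Q u\<^sub>i\<close> is the vertex \<open>q\<^sub>i\<close>.
\<close>

datatype 'a fowler_vertex = Old 'a | P 'a | Q 'a

definition fowler :: "'a pair_pre_digraph \<Rightarrow> 'a \<Rightarrow> 'a fowler_vertex pair_pre_digraph" where
  "fowler G v =
    (let N = neighbours G v;
         E = {(Old a, Old b) | a b. (a, b) \<in> parcs G \<and> a \<noteq> v \<and> b \<noteq> v}
           \<union> {(Old v, Q u) | u. u \<in> N}
           \<union> {(P u, Old u) | u. u \<in> N}
           \<union> {(P u, Q w) | u w. u \<in> N \<and> w \<in> N \<and> u \<noteq> w}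
     in \<lparr> pverts = Old ` pverts G \<union> P ` N \<union> Q ` N, parcs = E \<union> E\<inverse> \<rparr>)"

lemma pair_graph_fowler:
  assumes "pair_graph G" and "v \<in> pverts G"
  shows "pair_graph (fowler G v)"
proof -
  interpret G: pair_graph G by fact
  have sym: "(b, a) \<in> parcs G" if "(a, b) \<in> parcs G" for a b
    using G.pair_sym_arcs that by (auto simp: symmetric_def dest: symD)
  have in_verts: "a \<in> pverts G" "b \<in> pverts G" if "(a, b) \<in> parcs G" for a b
    using that G.arc_fst_in_verts G.arc_snd_in_verts by fastforce+
  have noloop: "(a, a) \<notin> parcs G" for a
    using G.pair_no_loops by fastforce
  let ?F = "fowler G v"
  have N: "neighbours G v \<subseteq> pverts G"
    using in_verts by (auto simp: neighbours_def)
  have fin: "finite (pverts ?F)"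
    using finite_subset[OF N] G.pair_finite_verts by (simp add: fowler_def Let_def)
  have wf: "parcs ?F \<subseteq> pverts ?F \<times> pverts ?F"
    using assms(2) N in_verts by (auto simp: fowler_def Let_def)
  have "finite (parcs ?F)"
    using finite_subset[OF wf] fin by blast
  moreover have "symmetric ?F"
    unfolding symmetric_def by (auto simp: fowler_def Let_def intro!: symI)
  moreover have "fst e \<noteq> snd e" if "e \<in> parcs ?F" for e
    using that noloop by (auto simp: fowler_def Let_def)
  ultimately show ?thesis
    using wf fin by unfold_locales auto
qed

end

theory Submission
  imports Defs "Jordan_Normal_Form.Schur_Decomposition"
begin

text \<open>
  Let \<open>v\<close> have degree \<open>\<rho>\<close>. In a kernel vector \<open>x\<close> of \<open>F(G, v)\<close>, the equations at the
  \<open>q\<^sub>i\<close> force all \<open>x(p\<^sub>i)\<close> to be equal to one number \<open>c\<close> and \<open>x(v) = (1 - \<rho>) c\<close>,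
  the equation at \<open>v\<close> says that the \<open>x(q\<^sub>i)\<close> sum to 0, and the equations at the \<open>p\<^sub>i\<close> then give
  \<open>x(q\<^sub>i) = x(u\<^sub>i)\<close>. The remaining equations say that replacing the value at \<open>v\<close>
  by \<open>c\<close> gives a kernel vector of \<open>G\<close>, so the two kernels are isomorphic. The isomorphism
  respects the absence of zero entries unless \<open>\<rho> = 1\<close>, and then neither graph is a nut graph.
  Since the nullity is an algebraic multiplicity, it has to be compared with the dimension of
  the kernel, which uses that the adjacency matrix is symmetric.
\<close>

section \<open>Symmetric matrices with a simple eigenvalue 0\<close>

text \<open>Gram-Schmidt, applied to a completion of \<open>y\<close> to a basis, keeps
  \<open>y\<close> as the first vector. A square matrix with nonzero orthogonal columns is inverted
  by its rescaled conjugate transpose \<open>corthogonal_inv\<close>.\<close>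

lemma obtain_invertible_mat_first_col:
  fixes y :: "'a :: conjugatable_ordered_field vec"
  assumes y: "y \<in> carrier_vec n" and y0: "y \<noteq> 0\<^sub>v n"
  obtains W W' where "W \<in> carrier_mat n n" "W' \<in> carrier_mat n n"
    "W * W' = 1\<^sub>m n" "W' * W = 1\<^sub>m n" "col W 0 = y"
proof -
  interpret cof_vec_space n "TYPE('a)" .
  define b where "b = basis_completion y"
  define ws where "ws = gram_schmidt n b"
  have n: "n \<noteq> 0"
    using y y0 by (metis carrier_vecD eq_vecI index_zero_vec(2) less_nat_zero_code)
  note bc = basis_completion[OF y y0, folded b_def]
  from n bc(6,7) obtain vs where bv: "b = y # vs"
    by (cases b) auto
  note gs = gram_schmidt_result[OF bc(2,4,5) ws_def]
  have len: "length ws = n"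
    using gs bc(6) by simp
  have hd: "hd ws = y"
    using gram_schmidt_hd[OF y, of vs] bv by (simp add: ws_def)
  define W where "W = mat_of_cols n ws"
  define W' where "W' = corthogonal_inv W"
  have W: "W \<in> carrier_mat n n"
    using len by (auto simp: W_def)
  have W': "W' \<in> carrier_mat n n"
    unfolding W'_def corthogonal_inv_def using W by (auto simp: mat_of_rows_def)
  have "inverts_mat W' W"
    unfolding W'_def by (rule corthogonal_inv_result)
      (use orthogonal_mat_of_cols[of ws n] gs len W_def in auto)
  then have W'W: "W' * W = 1\<^sub>m n"
    using W' by (simp add: inverts_mat_def)
  have "ws ! 0 \<in> carrier_vec n"
    using len n gs nth_mem[of 0 ws] by blast
  then have "col W 0 = ws ! 0"
    using len n by (simp add: W_def)
  then have "col W 0 = y"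
    using hd len n by (cases ws) auto
  with that[OF W W' mat_mult_left_right_inverse[OF W' W W'W] W'W] show ?thesis .
qed

lemma append_zero_vec_eq_smult_unit_vec:
  fixes w :: "'a :: semiring_1 vec"
  assumes "w \<in> carrier_vec 1"
  shows "w @\<^sub>v 0\<^sub>v m = w $ 0 \<cdot>\<^sub>v unit_vec (1 + m) 0"
  using assms by (intro eq_vecI) (auto simp: unit_vec_def)

text \<open>The characteristic polynomial is monic, hence nonzero, so order 0 at the point 0 means
  that 0 is not a root, and its roots are the eigenvalues.\<close>

lemma order_0_char_poly_eq_0_iff:
  fixes B :: "'a :: field mat"
  assumes B: "B \<in> carrier_mat m m"
  shows "Polynomial.order 0 (char_poly B) = 0 \<longleftrightarrow>
    (\<forall>u \<in> carrier_vec m. B *\<^sub>v u = 0\<^sub>v m \<longrightarrow> u = 0\<^sub>v m)"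
proof -
  have "char_poly B \<noteq> 0"
    using degree_monic_char_poly[OF B] by auto
  then have "Polynomial.order 0 (char_poly B) = 0 \<longleftrightarrow> \<not> eigenvalue B 0"
    by (simp add: eigenvalue_root_char_poly[OF B] order_root)
  also have "\<dots> \<longleftrightarrow> (\<forall>u \<in> carrier_vec m. B *\<^sub>v u = 0\<^sub>v m \<longrightarrow> u = 0\<^sub>v m)"
  proof -
    have "0 \<cdot>\<^sub>v u = 0\<^sub>v m" if "u \<in> carrier_vec m" for u :: "'a vec"
      using that by auto
    then show ?thesis
      using B by (auto simp: eigenvalue_def eigenvector_def)
  qed
  finally show ?thesis .
qed

text \<open>
  In a basis whose first vector is \<open>y\<close>, the matrix has the block form
  \<open>[0, R; 0, B]\<close>. A kernel vector of \<open>B\<close> yields a vector that \<open>A\<close> maps to a multiple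
  of \<open>y\<close>; by symmetry this multiple is orthogonal to \<open>y\<close> and therefore zero.
\<close>

lemma order_0_char_poly_symmetric_eq_1_iff:
  fixes A :: "real mat"
  assumes A: "A \<in> carrier_mat n n" and sym: "A\<^sup>T = A"
    and y: "y \<in> mat_kernel A" and y0: "y \<noteq> 0\<^sub>v n"
  shows "Polynomial.order 0 (char_poly A) = 1 \<longleftrightarrow> (\<forall>z \<in> mat_kernel A. \<exists>c. z = c \<cdot>\<^sub>v y)"
proof -
  have yc: "y \<in> carrier_vec n" and Ay: "A *\<^sub>v y = 0\<^sub>v n"
    using mat_kernelD[OF A y] by auto
  have "n \<noteq> 0"
    using yc y0 by (metis carrier_vecD eq_vecI index_zero_vec(2) less_nat_zero_code)
  then obtain m where n: "n = 1 + m"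
    by (cases n) auto
  obtain W W' where W: "W \<in> carrier_mat n n" and W': "W' \<in> carrier_mat n n"
    and WW': "W * W' = 1\<^sub>m n" and W'W: "W' * W = 1\<^sub>m n" and colW: "col W 0 = y"
    using obtain_invertible_mat_first_col[OF yc y0] .
  define A' where "A' = W' * A * W"
  have A': "A' \<in> carrier_mat n n"
    using W W' A by (auto simp: A'_def)
  \<comment> \<open>\<open>A'\<close> is \<open>A\<close> written in the basis formed by the columns
    of \<open>W\<close>.\<close>
  have AW: "A *\<^sub>v (W *\<^sub>v x) = W *\<^sub>v (A' *\<^sub>v x)" if x: "x \<in> carrier_vec n" for x
  proof -
    have "W *\<^sub>v (A' *\<^sub>v x) = (W * W') *\<^sub>v (A *\<^sub>v (W *\<^sub>v x))"
      unfolding A'_def using W W' A x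
      by (simp add: assoc_mult_mat_vec[of _ n n _ n])
    then show ?thesis
      using WW' A W x by simp
  qed
  have W_inj: "x = 0\<^sub>v n" if "x \<in> carrier_vec n" "W *\<^sub>v x = 0\<^sub>v n" for x
  proof -
    have "(W' * W) *\<^sub>v x = W' *\<^sub>v 0\<^sub>v n"
      using that W W' by (simp add: assoc_mult_mat_vec[of _ n n _ n])
    moreover have "W' *\<^sub>v 0\<^sub>v n = 0\<^sub>v n"
      using W' by auto
    ultimately show ?thesis
      using W'W that by simp
  qed
  have "W *\<^sub>v unit_vec n 0 = y"
    using W colW n by (intro eq_vecI) auto
  then have Wunit: "W *\<^sub>v (w @\<^sub>v 0\<^sub>v m) = w $ 0 \<cdot>\<^sub>v y" if "w \<in> carrier_vec 1" for w
    using mult_mat_vec[OF W unit_vec_carrier]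
    unfolding append_zero_vec_eq_smult_unit_vec[OF that] n[symmetric] by simp
  obtain A1 R A0 B where split: "split_block A' 1 1 = (A1, R, A0, B)"
    by (cases "split_block A' 1 1") auto
  have dims: "dim_row A' = 1 + m" "dim_col A' = 1 + m"
    using A' n by auto
  note sb = split_block[OF split dims]
  \<comment> \<open>The first basis vector \<open>y\<close> lies in the kernel of \<open>A\<close>,
    so the first column of \<open>A'\<close> vanishes.\<close>
  have "col A' 0 = (W' * A) *\<^sub>v y"
    unfolding A'_def colW[symmetric] using n by (intro col_mult2[OF mult_carrier_mat[OF W' A] W]) simp
  also have "\<dots> = W' *\<^sub>v (A *\<^sub>v y)"
    by (rule assoc_mult_mat_vec[OF W' A yc])
  finally have "col A' 0 = 0\<^sub>v n"
    using Ay W' by auto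
  then have A'0: "A' $$ (i, 0) = 0" if "i < n" for i
    using that dims n by (metis index_col index_zero_vec(1) zero_less_Suc plus_1_eq_Suc)
  have A1: "A1 = 0\<^sub>m 1 1" and A0: "A0 = 0\<^sub>m m 1"
    using split A'0 dims n by (auto simp: split_block_def Let_def)
  have R: "R \<in> carrier_mat 1 m" and B: "B \<in> carrier_mat m m"
    using sb by auto
  have A'eq: "A' = four_block_mat (0\<^sub>m 1 1) R (0\<^sub>m m 1) B"
    using sb(5) A1 A0 by simp
  have A'app: "A' *\<^sub>v (w @\<^sub>v u) = (R *\<^sub>v u) @\<^sub>v (B *\<^sub>v u)"
    if "w \<in> carrier_vec 1" "u \<in> carrier_vec m" for w u
    unfolding A'eq using that R B
    by (subst four_block_mat_mult_vec[of _ 1 1 _ m _ m]) auto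
  have "similar_mat A' A"
    using W W' A A' WW' W'W by (intro similar_matI[of _ _ W' W n]) (auto simp: A'_def)
  then have "char_poly A = char_poly A'"
    by (rule char_poly_similar[symmetric])
  also have "\<dots> = char_poly (0\<^sub>m 1 1 :: real mat) * char_poly B"
    unfolding A'eq by (rule char_poly_four_block_zeros_col[OF zero_carrier_mat R B])
  also have "char_poly (0\<^sub>m 1 1 :: real mat) = [:0, 1:]"
    by (simp add: char_poly_defs det_def sign_def)
  finally have factor: "char_poly A = [:0, 1:] * char_poly B" .
  have nz: "[:0, 1:] * char_poly B \<noteq> 0"
    using degree_monic_char_poly[OF B] by auto
  have "Polynomial.order 0 [:0, 1 :: real:] = 1"
    using order_power_n_n[of "0::real" 1] by simp
  then have "Polynomial.order 0 (char_poly A) = 1 + Polynomial.order 0 (char_poly B)"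
    unfolding factor Polynomial.order_mult[OF nz] by (rule arg_cong)
  then have "Polynomial.order 0 (char_poly A) = 1 \<longleftrightarrow>
      (\<forall>u \<in> carrier_vec m. B *\<^sub>v u = 0\<^sub>v m \<longrightarrow> u = 0\<^sub>v m)"
    using order_0_char_poly_eq_0_iff[OF B] by simp
  also have "\<dots> \<longleftrightarrow> (\<forall>z \<in> mat_kernel A. \<exists>c. z = c \<cdot>\<^sub>v y)"
  proof (intro iffI ballI impI)
    fix z
    assume ker: "\<forall>u \<in> carrier_vec m. B *\<^sub>v u = 0\<^sub>v m \<longrightarrow> u = 0\<^sub>v m" and "z \<in> mat_kernel A"
    then have z: "z \<in> carrier_vec n" "A *\<^sub>v z = 0\<^sub>v n"
      using mat_kernelD[OF A] by auto
    \<comment> \<open>Coordinates of \<open>z\<close> in the basis of columns of \<open>W\<close>: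
      \<open>w\<close> holds the coefficient of \<open>y\<close>, and \<open>u\<close> holds the
      others.\<close>
    define w u where "w = vec_first (W' *\<^sub>v z) 1" and "u = vec_last (W' *\<^sub>v z) m"
    have wu: "w \<in> carrier_vec 1" "u \<in> carrier_vec m" "W' *\<^sub>v z = w @\<^sub>v u"
      using W' z n by (auto simp: w_def u_def)
    have zeq: "z = W *\<^sub>v (w @\<^sub>v u)"
      using WW' W W' z by (simp flip: wu(3) add: assoc_mult_mat_vec[of W n n W' n, symmetric])
    have "w @\<^sub>v u \<in> carrier_vec n"
      unfolding wu(3)[symmetric] using W' z by auto
    then have "W *\<^sub>v (A' *\<^sub>v (w @\<^sub>v u)) = 0\<^sub>v n"
      using AW[of "w @\<^sub>v u"] z(2) zeq by metis
    then have "(R *\<^sub>v u) @\<^sub>v (B *\<^sub>v u) = 0\<^sub>v n"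
      using W_inj[OF mult_mat_vec_carrier[OF A']] A'app[OF wu(1,2)] \<open>w @\<^sub>v u \<in> carrier_vec n\<close>
      by metis
    also have "0\<^sub>v n = 0\<^sub>v 1 @\<^sub>v (0\<^sub>v m :: real vec)"
      unfolding n by (intro eq_vecI) auto
    finally have "B *\<^sub>v u = 0\<^sub>v m"
      using R wu append_vec_eq[of "R *\<^sub>v u" 1 "0\<^sub>v 1"] by auto
    with ker wu have "u = 0\<^sub>v m"
      by auto
    then show "\<exists>c. z = c \<cdot>\<^sub>v y"
      using zeq Wunit[OF wu(1)] by auto
  next
    fix u
    assume span: "\<forall>z \<in> mat_kernel A. \<exists>c. z = c \<cdot>\<^sub>v y"
      and u: "u \<in> carrier_vec m" and Bu: "B *\<^sub>v u = 0\<^sub>v m"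
    let ?x = "0\<^sub>v 1 @\<^sub>v u"
    let ?z = "W *\<^sub>v ?x"
    have x: "?x \<in> carrier_vec n"
      unfolding n using u by (intro append_carrier_vec) auto
    have z: "?z \<in> carrier_vec n"
      using W x by auto
    define r where "r = (R *\<^sub>v u) $ 0"
    have Az: "A *\<^sub>v ?z = r \<cdot>\<^sub>v y"
      unfolding AW[OF x] A'app[OF zero_carrier_vec u] Bu r_def
      by (rule Wunit[OF mult_mat_vec_carrier[OF R u]])
    have "r * (y \<bullet> y) = y \<bullet> (A *\<^sub>v ?z)"
      using Az yc by simp
    also have "\<dots> = (A\<^sup>T *\<^sub>v y) \<bullet> ?z"
      using transpose_vec_mult_scalar[OF A z yc] by simp
    also have "\<dots> = 0"
      using sym Ay z by simp
    finally have "r = 0"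
      using conjugate_square_eq_0_vec[OF yc] y0 by simp
    then have "A *\<^sub>v ?z = 0\<^sub>v n"
      using Az yc by auto
    then have "?z \<in> mat_kernel A"
      using mat_kernelI[OF A z] by simp
    with span obtain c where c: "?z = c \<cdot>\<^sub>v y"
      by auto
    \<comment> \<open>The multiple of \<open>y\<close> has coordinates \<open>c\<close> followed by
      zeros; those of \<open>?z\<close> are 0 followed by \<open>u\<close>. Comparing entries from
      index 1 on gives \<open>u = 0\<close>.\<close>
    define w where "w = vec 1 (\<lambda>_. c)"
    have w: "w \<in> carrier_vec 1"
      by (simp add: w_def)
    have w0: "w @\<^sub>v 0\<^sub>v m \<in> carrier_vec n"
      unfolding n using w by (intro append_carrier_vec) auto
    have "W *\<^sub>v (?x - (w @\<^sub>v 0\<^sub>v m)) = 0\<^sub>v n"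
      unfolding mult_minus_distrib_mat_vec[OF W x w0] Wunit[OF w] c
      using yc by (simp add: w_def)
    then have eq: "?x - (w @\<^sub>v 0\<^sub>v m) = 0\<^sub>v n"
      by (rule W_inj[OF minus_carrier_vec[OF x w0]])
    show "u = 0\<^sub>v m"
    proof (rule eq_vecI)
      fix i assume "i < dim_vec (0\<^sub>v m)"
      then show "u $ i = 0\<^sub>v m $ i"
        using arg_cong[OF eq, of "\<lambda>v. v $ (1 + i)"] u n w by simp
    qed (use u in auto)
  qed
  finally show ?thesis .
qed

section \<open>Nut graphs by kernel functions on the vertices\<close>

text \<open>Stating the kernel equations vertex by vertex frees the later arguments from the chosen
  enumeration. In a \<open>pair_graph\<close>, values off the vertex set are unconstrained, so
  kernel functions are compared on vertices only.\<close>

definition kernel_fun :: "'a pair_pre_digraph \<Rightarrow> ('a \<Rightarrow> real) \<Rightarrow> bool" where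
  "kernel_fun G f \<longleftrightarrow> (\<forall>a \<in> pverts G. (\<Sum>b \<in> neighbours G a. f b) = 0)"

lemma (in pair_wf_digraph) neighbours_subset: "neighbours G a \<subseteq> pverts G"
  using in_arcsD2 by (auto simp: neighbours_def)

lemma neighbours_sym:
  assumes "pair_graph G"
  shows "b \<in> neighbours G a \<longleftrightarrow> a \<in> neighbours G b"
proof -
  interpret pair_graph G by fact
  show ?thesis
    using pair_sym_arcs by (auto simp: neighbours_def symmetric_def dest: symD)
qed

lemma not_neighbours_self:
  assumes "pair_graph G"
  shows "a \<notin> neighbours G a"
proof -
  interpret pair_graph G by fact
  show ?thesis
    using pair_no_loops by (fastforce simp: neighbours_def)
qed

definition vertex_vec :: "'a pair_pre_digraph \<Rightarrow> ('a \<Rightarrow> real) \<Rightarrow> real vec" where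
  "vertex_vec G f = vec (length (vertex_list G)) (\<lambda>i. f (vertex_list G ! i))"

lemma adjacency_matrix_carrier:
  "adjacency_matrix G \<in> carrier_mat (length (vertex_list G)) (length (vertex_list G))"
  by (simp add: adjacency_matrix_def Let_def)

lemma vertex_vec_in_mat_kernel_iff:
  assumes "pair_graph G"
  shows "vertex_vec G f \<in> mat_kernel (adjacency_matrix G) \<longleftrightarrow> kernel_fun G f"
proof -
  interpret pair_graph G by fact
  let ?vs = "vertex_list G" and ?A = "adjacency_matrix G"
  let ?n = "length ?vs"
  note vs = vertex_list[OF pair_finite_verts]
  have entry: "(?A *\<^sub>v vertex_vec G f) $ i = (\<Sum>b \<in> neighbours G (?vs ! i). f b)"
    if i: "i < ?n" for i
  proof -
    have "(?A *\<^sub>v vertex_vec G f) $ i =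
        (\<Sum>j < ?n. if (?vs ! i, ?vs ! j) \<in> parcs G then f (?vs ! j) else 0)"
      using i by (auto simp: adjacency_matrix_def vertex_vec_def Let_def scalar_prod_def
          atLeast0LessThan intro!: sum.cong)
    also have "\<dots> = (\<Sum>b \<in> pverts G. if (?vs ! i, b) \<in> parcs G then f b else 0)"
      using bij_betw_nth[OF vs(1) refl vs(2)[symmetric]]
      by (rule sum.reindex_bij_betw)
    also have "\<dots> = (\<Sum>b \<in> pverts G \<inter> neighbours G (?vs ! i). f b)"
      by (simp add: sum.inter_restrict neighbours_def)
    also have "pverts G \<inter> neighbours G (?vs ! i) = neighbours G (?vs ! i)"
      using neighbours_subset by blast
    finally show ?thesis .
  qed
  have "vertex_vec G f \<in> mat_kernel ?A \<longleftrightarrow> ?A *\<^sub>v vertex_vec G f = 0\<^sub>v ?n"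
    using mat_kernel[OF adjacency_matrix_carrier] by (auto simp: vertex_vec_def)
  also have "\<dots> \<longleftrightarrow> (\<forall>i < ?n. (\<Sum>b \<in> neighbours G (?vs ! i). f b) = 0)"
    using entry adjacency_matrix_carrier[of G] by (auto simp: vec_eq_iff)
  also have "\<dots> \<longleftrightarrow> kernel_fun G f"
    unfolding kernel_fun_def vs(2)[symmetric] by (metis in_set_conv_nth)
  finally show ?thesis .
qed

lemma vertex_vec_eq_smult_iff:
  assumes "pair_graph G"
  shows "vertex_vec G g = c \<cdot>\<^sub>v vertex_vec G f \<longleftrightarrow> (\<forall>a \<in> pverts G. g a = c * f a)"
proof -
  interpret pair_graph G by fact
  show ?thesis
    unfolding vertex_list(2)[OF pair_finite_verts, symmetric]
    by (auto simp: vertex_vec_def vec_eq_iff all_set_conv_all_nth)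
qed

lemma obtain_vertex_vec:
  assumes "pair_graph G" "x \<in> mat_kernel (adjacency_matrix G)"
  obtains f where "x = vertex_vec G f" "kernel_fun G f"
proof -
  interpret pair_graph G by fact
  let ?vs = "vertex_list G"
  have "distinct ?vs"
    by (rule vertex_list(1)[OF pair_finite_verts])
  moreover have "x \<in> carrier_vec (length ?vs)"
    using mat_kernelD(1)[OF adjacency_matrix_carrier assms(2)] .
  ultimately have "x = vertex_vec G (\<lambda>a. x $ (the_inv_into {..<length ?vs} ((!) ?vs) a))"
    by (intro eq_vecI) (auto simp: vertex_vec_def the_inv_into_f_f inj_on_nth)
  with that assms vertex_vec_in_mat_kernel_iff show ?thesis
    by metis
qed

text \<open>A core vertex supplies a nonzero kernel function, and nullity one makes it span the
  kernel. The empty graph would satisfy the right-hand side vacuously, although its nullity is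
  0.\<close>

lemma nut_graph_iff:
  assumes "pair_graph G" and "pverts G \<noteq> {}"
  shows "nut_graph G \<longleftrightarrow> (\<exists>f. kernel_fun G f \<and> (\<forall>a \<in> pverts G. f a \<noteq> 0) \<and>
    (\<forall>g. kernel_fun G g \<longrightarrow> (\<exists>c. \<forall>a \<in> pverts G. g a = c * f a)))"
proof -
  interpret pair_graph G by fact
  let ?vs = "vertex_list G" and ?A = "adjacency_matrix G"
  let ?n = "length ?vs"
  note vs = vertex_list[OF pair_finite_verts]
  note A = adjacency_matrix_carrier[of G]
  have sym: "?A\<^sup>T = ?A"
    using neighbours_sym[OF assms(1)]
    by (intro eq_matI) (auto simp: adjacency_matrix_def Let_def neighbours_def)
  have nonzero: "vertex_vec G f \<noteq> 0\<^sub>v ?n" if "a \<in> pverts G" "f a \<noteq> 0" for f a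
    using that unfolding vs(2)[symmetric] by (auto simp: vertex_vec_def vec_eq_iff in_set_conv_nth)
  have core: "core_vertex G a \<longleftrightarrow> (\<exists>f. kernel_fun G f \<and> f a \<noteq> 0)" if a: "a \<in> pverts G" for a
  proof -
    obtain i where i: "i < ?n" "?vs ! i = a"
      using a vs(2) by (metis in_set_conv_nth)
    then have entry: "vertex_vec G f $ i = f a" for f
      by (simp add: vertex_vec_def)
    \<comment> \<open>Distinctness leaves \<open>i\<close> as the only index of \<open>a\<close>, so
      the existential over indices collapses.\<close>
    have index: "j = i" if "j < ?n" "?vs ! j = a" for j
      using i that nth_eq_iff_index_eq[OF vs(1) that(1) i(1)] by simp
    have "core_vertex G a \<longleftrightarrow> (\<exists>x \<in> mat_kernel ?A. x $ i \<noteq> 0)"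
      unfolding core_vertex_def
    proof (intro bex_cong refl iffI)
      fix x :: "real vec"
      assume "\<exists>j < ?n. ?vs ! j = a \<and> x $ j \<noteq> 0"
      then show "x $ i \<noteq> 0"
        using index by blast
    next
      fix x :: "real vec"
      assume "x $ i \<noteq> 0"
      with i show "\<exists>j < ?n. ?vs ! j = a \<and> x $ j \<noteq> 0"
        by blast
    qed
    also have "\<dots> \<longleftrightarrow> (\<exists>f. kernel_fun G f \<and> f a \<noteq> 0)"
    proof
      assume "\<exists>x \<in> mat_kernel ?A. x $ i \<noteq> 0"
      then show "\<exists>f. kernel_fun G f \<and> f a \<noteq> 0"
        using obtain_vertex_vec[OF assms(1)] entry by (metis (no_types))
    next
      assume "\<exists>f. kernel_fun G f \<and> f a \<noteq> 0"
      then show "\<exists>x \<in> mat_kernel ?A. x $ i \<noteq> 0"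
        using vertex_vec_in_mat_kernel_iff[OF assms(1)] entry by metis
    qed
    finally show ?thesis .
  qed
  \<comment> \<open>Symmetry of the adjacency matrix turns the algebraic multiplicity into a
    statement about the span of one nonzero kernel vector.\<close>
  have span: "nullity G = 1 \<longleftrightarrow> (\<forall>g. kernel_fun G g \<longrightarrow> (\<exists>c. \<forall>a \<in> pverts G. g a = c * f a))"
    if f: "kernel_fun G f" "a \<in> pverts G" "f a \<noteq> 0" for f a
  proof -
    have "nullity G = 1 \<longleftrightarrow> (\<forall>z \<in> mat_kernel ?A. \<exists>c. z = c \<cdot>\<^sub>v vertex_vec G f)"
      unfolding nullity_def
      using f vertex_vec_in_mat_kernel_iff[OF assms(1)] nonzero
      by (intro order_0_char_poly_symmetric_eq_1_iff[OF A sym]) auto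
    also have "\<dots> \<longleftrightarrow> (\<forall>g. kernel_fun G g \<longrightarrow> (\<exists>c. vertex_vec G g = c \<cdot>\<^sub>v vertex_vec G f))"
      using obtain_vertex_vec[OF assms(1)] vertex_vec_in_mat_kernel_iff[OF assms(1)] by metis
    finally show ?thesis
      by (simp add: vertex_vec_eq_smult_iff[OF assms(1)])
  qed
  show ?thesis
  proof
    assume nut: "nut_graph G"
    obtain a0 where a0: "a0 \<in> pverts G"
      using assms(2) by blast
    obtain f where f: "kernel_fun G f" "f a0 \<noteq> 0"
      using nut core[OF a0] a0 by (auto simp: nut_graph_def core_graph_def)
    have sp: "\<forall>g. kernel_fun G g \<longrightarrow> (\<exists>c. \<forall>a \<in> pverts G. g a = c * f a)"
      using nut span[OF f(1) a0 f(2)] by (simp add: nut_graph_def)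
    \<comment> \<open>A kernel function that is nonzero at \<open>a\<close> is a multiple of
      \<open>f\<close>, so \<open>f\<close> cannot vanish there.\<close>
    moreover have "f a \<noteq> 0" if a: "a \<in> pverts G" for a
    proof -
      obtain g where "kernel_fun G g" "g a \<noteq> 0"
        using nut core[OF a] a by (auto simp: nut_graph_def core_graph_def)
      with sp a show ?thesis
        by fastforce
    qed
    ultimately show "\<exists>f. kernel_fun G f \<and> (\<forall>a \<in> pverts G. f a \<noteq> 0) \<and>
        (\<forall>g. kernel_fun G g \<longrightarrow> (\<exists>c. \<forall>a \<in> pverts G. g a = c * f a))"
      using f by blast
  next
    assume "\<exists>f. kernel_fun G f \<and> (\<forall>a \<in> pverts G. f a \<noteq> 0) \<and>
        (\<forall>g. kernel_fun G g \<longrightarrow> (\<exists>c. \<forall>a \<in> pverts G. g a = c * f a))"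
    then obtain f where f: "kernel_fun G f" "\<forall>a \<in> pverts G. f a \<noteq> 0"
      "\<forall>g. kernel_fun G g \<longrightarrow> (\<exists>c. \<forall>a \<in> pverts G. g a = c * f a)"
      by blast
    obtain a0 where a0: "a0 \<in> pverts G"
      using assms(2) by blast
    have y: "vertex_vec G f \<in> carrier_vec ?n" "?A *\<^sub>v vertex_vec G f = 0\<^sub>v ?n"
      using mat_kernelD[OF A] vertex_vec_in_mat_kernel_iff[OF assms(1)] f(1) by blast+
    have "singular_graph G"
      unfolding singular_graph_def
    proof
      assume "invertible_mat ?A"
      then obtain B where AB: "?A * B = 1\<^sub>m ?n" and BA: "B * ?A = 1\<^sub>m (dim_row B)"
        using A by (auto simp: invertible_mat_def inverts_mat_def)
      \<comment> \<open>The dimensions of the inverse are not part of \<open>invertible_mat\<close>;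
        comparing the column counts in both identities fixes them.\<close>
      have B: "B \<in> carrier_mat ?n ?n"
        using arg_cong[OF AB, of dim_col] arg_cong[OF BA, of dim_col] A by auto
      have "vertex_vec G f = (B * ?A) *\<^sub>v vertex_vec G f"
        using BA B y by simp
      also have "\<dots> = B *\<^sub>v 0\<^sub>v ?n"
        using assoc_mult_mat_vec[OF B A y(1)] y(2) by simp
      also have "\<dots> = 0\<^sub>v ?n"
        using B by auto
      finally show False
        using nonzero a0 f(2) by blast
    qed
    then show "nut_graph G"
      using f core span[OF f(1) a0] a0 by (auto simp: nut_graph_def core_graph_def)
  qed
qed

section \<open>Kernel functions of the Fowler construction\<close>

lemma neighbours_fowler:
  assumes "pair_graph G"
  shows "neighbours (fowler G v) (Old v) = Q ` neighbours G v"
    and "a \<noteq> v \<Longrightarrow> neighbours (fowler G v) (Old a) =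
      Old ` (neighbours G a - {v}) \<union> (if v \<in> neighbours G a then {P a} else {})"
    and "u \<in> neighbours G v \<Longrightarrow>
      neighbours (fowler G v) (P u) = insert (Old u) (Q ` (neighbours G v - {u}))"
    and "u \<in> neighbours G v \<Longrightarrow>
      neighbours (fowler G v) (Q u) = insert (Old v) (P ` (neighbours G v - {u}))"
  using neighbours_sym[OF assms] not_neighbours_self[OF assms]
  by (auto simp: fowler_def neighbours_def Let_def)

context
  fixes G :: "'a pair_pre_digraph" and v :: 'a
  assumes G: "pair_graph G" and v: "v \<in> pverts G"
begin

lemma finite_neighbours: "finite (neighbours G a)"
proof -
  interpret pair_graph G by (rule G)
  show ?thesis
    using finite_subset[OF neighbours_subset pair_finite_verts] .
qed

lemma neighbour_in_pverts: "u \<in> neighbours G a \<Longrightarrow> u \<in> pverts G"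
proof -
  interpret pair_graph G by (rule G)
  show "u \<in> neighbours G a \<Longrightarrow> u \<in> pverts G"
    using neighbours_subset by blast
qed

lemma pverts_fowler: "pverts (fowler G v) = Old ` pverts G \<union> P ` neighbours G v \<union> Q ` neighbours G v"
  by (simp add: fowler_def Let_def)

text \<open>The conjuncts come from \<open>v\<close>, the other old vertices, the \<open>P u\<close>
  and the \<open>Q u\<close>. In the last two, the sum is completed to all neighbours, and the term
  of the missing edge between \<open>P u\<close> and \<open>Q u\<close> moves to the right.\<close>

lemma kernel_fun_fowler_iff:
  "kernel_fun (fowler G v) x \<longleftrightarrow>
    (\<Sum>u\<in>neighbours G v. x (Q u)) = 0 \<and>
    (\<forall>a \<in> pverts G - {v}. (\<Sum>b \<in> neighbours G a - {v}. x (Old b)) +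
       (if v \<in> neighbours G a then x (P a) else 0) = 0) \<and>
    (\<forall>u \<in> neighbours G v. x (Old u) + (\<Sum>w\<in>neighbours G v. x (Q w)) = x (Q u)) \<and>
    (\<forall>u \<in> neighbours G v. x (Old v) + (\<Sum>w\<in>neighbours G v. x (P w)) = x (P u))"
proof -
  have sum_old_v: "(\<Sum>b \<in> neighbours (fowler G v) (Old v). x b) = (\<Sum>u\<in>neighbours G v. x (Q u))"
    by (simp add: neighbours_fowler[OF G] sum.reindex inj_on_def)
  have sum_old: "(\<Sum>b \<in> neighbours (fowler G v) (Old a). x b) =
      (\<Sum>b \<in> neighbours G a - {v}. x (Old b)) + (if v \<in> neighbours G a then x (P a) else 0)"
    if "a \<noteq> v" for a
    using finite_neighbours
    by (subst neighbours_fowler(2)[OF G that], subst sum.union_disjoint)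
      (auto simp: sum.reindex inj_on_def)
  have sum_P: "(\<Sum>b \<in> neighbours (fowler G v) (P u). x b) =
      x (Old u) + (\<Sum>w\<in>neighbours G v. x (Q w)) - x (Q u)" if "u \<in> neighbours G v" for u
    using that finite_neighbours
    by (subst neighbours_fowler(3)[OF G that], subst sum.insert)
      (auto simp: sum.reindex inj_on_def sum_diff1)
  have sum_Q: "(\<Sum>b \<in> neighbours (fowler G v) (Q u). x b) =
      x (Old v) + (\<Sum>w\<in>neighbours G v. x (P w)) - x (P u)" if "u \<in> neighbours G v" for u
    using that finite_neighbours
    by (subst neighbours_fowler(4)[OF G that], subst sum.insert)
      (auto simp: sum.reindex inj_on_def sum_diff1)
  have "kernel_fun (fowler G v) x \<longleftrightarrow>
    (\<Sum>b \<in> neighbours (fowler G v) (Old v). x b) = 0 \<and>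
    (\<forall>a \<in> pverts G - {v}. (\<Sum>b \<in> neighbours (fowler G v) (Old a). x b) = 0) \<and>
    (\<forall>u \<in> neighbours G v. (\<Sum>b \<in> neighbours (fowler G v) (P u). x b) = 0) \<and>
    (\<forall>u \<in> neighbours G v. (\<Sum>b \<in> neighbours (fowler G v) (Q u). x b) = 0)"
    using v by (auto simp: kernel_fun_def pverts_fowler)
  then show ?thesis
    by (simp add: sum_old_v sum_old sum_P sum_Q)
qed

section \<open>Correspondence between the kernels of \<open>G\<close> and of its Fowler
  construction\<close>

lemma sum_neighbours_remove:
  fixes y :: "'a \<Rightarrow> real"
  shows "(\<Sum>b \<in> neighbours G a. y b) =
    (\<Sum>b \<in> neighbours G a - {v}. y b) + (if v \<in> neighbours G a then y v else 0)"
  using finite_neighbours by (simp add: sum_diff1)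

text \<open>Each \<open>P u\<close> takes over the role of \<open>v\<close>, and each
  \<open>Q u\<close> copies \<open>u\<close>. With \<rho> neighbours, the equation at
  \<open>Q u\<close> reads x(v) + (\<rho> - 1) y(v) = 0, whence the factor at \<open>Old v\<close>.
  An isolated \<open>v\<close> keeps its value.\<close>

definition fowler_lift :: "('a \<Rightarrow> real) \<Rightarrow> 'a fowler_vertex \<Rightarrow> real" where
  "fowler_lift y x = (case x of
     Old a \<Rightarrow> if a = v then (1 - real (card (neighbours G v))) * y v else y a
   | P u \<Rightarrow> y v
   | Q u \<Rightarrow> y u)"

text \<open>The equation of \<open>y\<close> at \<open>v\<close> makes the values at the
  \<open>Q u\<close> sum to 0. At a neighbour \<open>a\<close> of \<open>v\<close>, the lost term
  \<open>y v\<close> is supplied by \<open>P a\<close>.\<close>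

lemma kernel_fun_fowler_lift:
  assumes y: "kernel_fun G y"
  shows "kernel_fun (fowler G v) (fowler_lift y)"
proof -
  have Q0: "(\<Sum>u\<in>neighbours G v. y u) = 0"
    using y v by (simp add: kernel_fun_def)
  have vN: "v \<notin> neighbours G v"
    by (rule not_neighbours_self[OF G])
  show ?thesis
    unfolding kernel_fun_fowler_iff
  proof (intro conjI ballI)
    fix a assume "a \<in> pverts G - {v}"
    then have "(\<Sum>b \<in> neighbours G a. y b) = 0"
      using y by (simp add: kernel_fun_def)
    moreover have "(\<Sum>b \<in> neighbours G a - {v}. fowler_lift y (Old b)) =
        (\<Sum>b \<in> neighbours G a - {v}. y b)"
      by (intro sum.cong) (auto simp: fowler_lift_def)
    moreover have "fowler_lift y (P a) = y v"
      by (simp add: fowler_lift_def)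
    ultimately show "(\<Sum>b \<in> neighbours G a - {v}. fowler_lift y (Old b)) +
        (if v \<in> neighbours G a then fowler_lift y (P a) else 0) = 0"
      using sum_neighbours_remove[of y a] by metis
  qed (use Q0 vN in \<open>auto simp: fowler_lift_def algebra_simps\<close>)
qed

text \<open>This is surjectivity of the lift on kernels, up to values off the vertex set, which the
  equations do not see.\<close>

lemma kernel_fun_fowlerE:
  assumes x: "kernel_fun (fowler G v) x"
  obtains y where "kernel_fun G y" "\<And>a. a \<in> pverts (fowler G v) \<Longrightarrow> x a = fowler_lift y a"
proof -
  have Q0: "(\<Sum>u\<in>neighbours G v. x (Q u)) = 0"
    and old: "\<And>a. a \<in> pverts G \<Longrightarrow> a \<noteq> v \<Longrightarrow> (\<Sum>b \<in> neighbours G a - {v}. x (Old b)) +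
       (if v \<in> neighbours G a then x (P a) else 0) = 0"
    and P: "\<And>u. u \<in> neighbours G v \<Longrightarrow> x (Old u) + (\<Sum>w\<in>neighbours G v. x (Q w)) = x (Q u)"
    and Q: "\<And>u. u \<in> neighbours G v \<Longrightarrow> x (Old v) + (\<Sum>w\<in>neighbours G v. x (P w)) = x (P u)"
    using x unfolding kernel_fun_fowler_iff by auto
  \<comment> \<open>This is the common value of the \<open>x (P u)\<close>, and \<open>x (Old v)\<close> if \<open>v\<close> is isolated.\<close>
  define c where "c = x (Old v) + (\<Sum>w\<in>neighbours G v. x (P w))"
  define y where "y = (\<lambda>a. if a = v then c else x (Old a))"
  have xP: "x (P u) = c" if "u \<in> neighbours G v" for u
    using Q[OF that] by (simp add: c_def)
  have xQ: "x (Q u) = x (Old u)" if "u \<in> neighbours G v" for u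
    using P[OF that] Q0 by simp
  have vN: "v \<notin> neighbours G v"
    by (rule not_neighbours_self[OF G])
  have "(\<Sum>w\<in>neighbours G v. x (P w)) = real (card (neighbours G v)) * c"
    using xP by simp
  \<comment> \<open>The definition of \<open>c\<close> now reads c = x(v) + \<rho> c, with \<rho>
    the degree of \<open>v\<close>.\<close>
  then have xv: "x (Old v) = (1 - real (card (neighbours G v))) * c"
    by (simp add: c_def algebra_simps)
  have "(\<Sum>b \<in> neighbours G a. y b) = 0" if a: "a \<in> pverts G" for a
  proof (cases "a = v")
    case True
    have "(\<Sum>b\<in>neighbours G v. y b) = (\<Sum>u\<in>neighbours G v. x (Q u))"
      using vN xQ by (intro sum.cong) (auto simp: y_def)
    with Q0 True show ?thesis
      by simp
  next
    case False
    have "(\<Sum>b \<in> neighbours G a - {v}. y b) = (\<Sum>b \<in> neighbours G a - {v}. x (Old b))"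
      by (intro sum.cong) (auto simp: y_def)
    with old[OF a False] show ?thesis
      using xP neighbours_sym[OF G, of v a]
      by (subst sum_neighbours_remove) (auto simp: y_def split: if_splits)
  qed
  then have "kernel_fun G y"
    by (simp add: kernel_fun_def)
  moreover have "x a = fowler_lift y a" if "a \<in> pverts (fowler G v)" for a
    using that xP xQ xv vN by (auto simp: pverts_fowler fowler_lift_def y_def)
  ultimately show ?thesis
    using that by blast
qed

text \<open>The lift is linear and injective on vertex values; this is what transfers the spanning
  condition.\<close>

lemma fowler_lift_eq_smult_iff:
  "(\<forall>a \<in> pverts (fowler G v). fowler_lift g a = c * fowler_lift f a) \<longleftrightarrow>
    (\<forall>a \<in> pverts G. g a = c * f a)" (is "?L \<longleftrightarrow> ?R")
proof
  assume L: ?L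
  \<comment> \<open>The factor at \<open>Old v\<close> vanishes if \<open>v\<close> has degree 1, so
    the value at \<open>v\<close> is read off at some \<open>P u\<close>. Without neighbours the
    factor is 1, and \<open>Old v\<close> serves.\<close>
  have "g v = c * f v"
  proof (cases "neighbours G v = {}")
    case True
    have "Old v \<in> pverts (fowler G v)"
      using v by (simp add: pverts_fowler)
    with L True show ?thesis
      by (force simp: fowler_lift_def)
  next
    case False
    then obtain u where "u \<in> neighbours G v"
      by blast
    then have "P u \<in> pverts (fowler G v)"
      by (simp add: pverts_fowler)
    with L show ?thesis
      by (force simp: fowler_lift_def)
  qed
  moreover have "g a = c * f a" if "a \<in> pverts G" "a \<noteq> v" for a
    using L[rule_format, of "Old a"] that by (simp add: pverts_fowler fowler_lift_def)
  ultimately show ?R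
    by blast
next
  assume ?R
  then show ?L
    using v neighbour_in_pverts by (auto simp: pverts_fowler fowler_lift_def)
qed

text \<open>The lift copies values of \<open>f\<close> except at \<open>Old v\<close>, where the
  factor is zero exactly for degree 1.\<close>

lemma fowler_lift_nonzero_iff:
  assumes f: "kernel_fun G f"
  shows "(\<forall>a \<in> pverts (fowler G v). fowler_lift f a \<noteq> 0) \<longleftrightarrow> (\<forall>a \<in> pverts G. f a \<noteq> 0)"
    (is "?L \<longleftrightarrow> ?R")
proof
  assume L: ?L
  have "f v \<noteq> 0"
    using L v by (force simp: pverts_fowler fowler_lift_def)
  moreover have "f a \<noteq> 0" if "a \<in> pverts G" "a \<noteq> v" for a
    using L[rule_format, of "Old a"] that by (simp add: pverts_fowler fowler_lift_def)
  ultimately show ?R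
    by blast
next
  assume R: ?R
  \<comment> \<open>The kernel equation at a leaf \<open>v\<close> makes \<open>f\<close> vanish at its neighbour.\<close>
  have "card (neighbours G v) \<noteq> 1"
  proof
    assume "card (neighbours G v) = 1"
    then obtain u where "neighbours G v = {u}"
      by (auto simp: card_1_singleton_iff)
    then have "u \<in> pverts G" "f u = 0"
      using neighbour_in_pverts[of u v] f v by (auto simp: kernel_fun_def)
    with R show False
      by blast
  qed
  then show ?L
    using R v neighbour_in_pverts by (auto simp: pverts_fowler fowler_lift_def split: if_splits)
qed

end

section \<open>Transfer of the nut property along the lift\<close>

theorem theorem4:
  fixes G :: "'a pair_pre_digraph" and v :: 'a
  assumes "pair_graph G" and "v \<in> pverts G"
  shows "nut_graph G \<longleftrightarrow> nut_graph (fowler G v)"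
proof -
  let ?F = "fowler G v" and ?lift = "fowler_lift G v"
  note lift = kernel_fun_fowler_lift[OF assms] kernel_fun_fowlerE[OF assms]
    fowler_lift_eq_smult_iff[OF assms] fowler_lift_nonzero_iff[OF assms]
  have F: "pair_graph ?F" "pverts ?F \<noteq> {}"
    using pair_graph_fowler[OF assms] assms(2) pverts_fowler[OF assms] by auto
  \<comment> \<open>Every kernel function of \<open>?F\<close> agrees on the vertices with a lift,
    so spanning can be tested on lifts.\<close>
  have span_iff: "(\<forall>x. kernel_fun ?F x \<longrightarrow> (\<exists>c. \<forall>a \<in> pverts ?F. x a = c * ?lift f a)) \<longleftrightarrow>
      (\<forall>g. kernel_fun G g \<longrightarrow> (\<exists>c. \<forall>a \<in> pverts G. g a = c * f a))" for f
  proof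
    assume "\<forall>x. kernel_fun ?F x \<longrightarrow> (\<exists>c. \<forall>a \<in> pverts ?F. x a = c * ?lift f a)"
    then show "\<forall>g. kernel_fun G g \<longrightarrow> (\<exists>c. \<forall>a \<in> pverts G. g a = c * f a)"
      using lift(1,3) by metis
  next
    assume sp: "\<forall>g. kernel_fun G g \<longrightarrow> (\<exists>c. \<forall>a \<in> pverts G. g a = c * f a)"
    show "\<forall>x. kernel_fun ?F x \<longrightarrow> (\<exists>c. \<forall>a \<in> pverts ?F. x a = c * ?lift f a)"
    proof (intro allI impI)
      fix x assume "kernel_fun ?F x"
      then obtain g where g: "kernel_fun G g" "\<And>a. a \<in> pverts ?F \<Longrightarrow> x a = ?lift g a"
        using lift(2) by blast
      from sp g(1) obtain c where "\<forall>a \<in> pverts ?F. ?lift g a = c * ?lift f a"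
        using lift(3) by metis
      with g(2) show "\<exists>c. \<forall>a \<in> pverts ?F. x a = c * ?lift f a"
        by auto
    qed
  qed
  have "nut_graph ?F \<longleftrightarrow> (\<exists>x. kernel_fun ?F x \<and> (\<forall>a \<in> pverts ?F. x a \<noteq> 0) \<and>
      (\<forall>x'. kernel_fun ?F x' \<longrightarrow> (\<exists>c. \<forall>a \<in> pverts ?F. x' a = c * x a)))"
    by (rule nut_graph_iff[OF F])
  \<comment> \<open>The conditions on \<open>x\<close> involve only its values on the vertices, so
    \<open>x\<close> may be replaced by the lift agreeing with it there.\<close>
  also have "\<dots> \<longleftrightarrow> (\<exists>f. kernel_fun G f \<and> (\<forall>a \<in> pverts ?F. ?lift f a \<noteq> 0) \<and>
      (\<forall>x'. kernel_fun ?F x' \<longrightarrow> (\<exists>c. \<forall>a \<in> pverts ?F. x' a = c * ?lift f a)))"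
    (is "(\<exists>x. ?A x) \<longleftrightarrow> (\<exists>f. ?B f)")
  proof
    assume "\<exists>x. ?A x"
    then obtain x where x: "?A x"
      by blast
    then obtain f where "kernel_fun G f" "\<And>a. a \<in> pverts ?F \<Longrightarrow> x a = ?lift f a"
      using lift(2) by blast
    with x show "\<exists>f. ?B f"
      by (intro exI[of _ f]) simp
  qed (use lift(1) in blast)
  also have "\<dots> \<longleftrightarrow> nut_graph G"
    using lift(4) assms(2) by (subst nut_graph_iff[OF assms(1)]) (auto simp: span_iff)
  finally show ?thesis ..
qed

end
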